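(* Let $x_1,\dots,x_n\in\mathbb{R}^p$ be data points, let $\varepsilon>0$, and let $M=D^{-1}L$ be the Markov matrix of the Gaussian-kernel random walk on these points, with eigenvalues $1=\lambda_0>\lambda_1\ge\dots\ge\lambda_{n-1}\ge 0$, left eigenvectors $\phi_j$ and right eigenvectors $\psi_j$ ($0\le j\le n-1$) normalized as in the context. Let $t\ge 0$ be an integer (number of time steps), and let $p(t,y|x)$ be the $t$-step transition probability from $x$ to $y$. For data points $x_a,x_b$ define the diffusion distance at time $t$ by $$D_t^2(x_a,x_b)=\sum_{y}\bigl(p(t,y|x_a)-p(t,y|x_b)\bigr)^2\,\frac{1}{\phi_0(y)},$$ where the sum is over all $n$ data points $y$, and define the diffusion map with all $n-1$ eigenvectors by $$\Psi_t(x)=\bigl(\lambda_1^t\psi_1(x),\lambda_2^t\psi_2(x),\dots,\lambda_{n-1}^t\psi_{n-1}(x)\bigr)\in\mathbb{R}^{n-1}.$$ Then the diffusion distance equals the Euclidean distance in the diffusion map space: for all data points $x_a,x_b$, $$D_t^2(x_a,x_b)=\sum_{j=1}^{n-1}\lambda_j^{2t}\bigl(\psi_j(x_a)-\psi_j(x_b)\bigr)^2=\|\Psi_t(x_a)-\Psi_t(x_b)\|^2 .$$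
   Context: $L$ is the $n\times n$ matrix $L_{i,j}=\exp\bigl(-\|x_i-x_j\|^2/(2\varepsilon)\bigr)$, $D$ is the diagonal matrix with $D_{i,i}=\sum_j L_{i,j}$, and $M=D^{-1}L$. $M$ is a row-stochastic matrix and $M_{i,j}$ is the probability that the random walk jumps from $x_i$ to $x_j$ in one time step. Functions on the data points are identified with vectors in $\mathbb{R}^n$, i.e. $f(x_i)=f_i$, and sums over $y$ run over the indices $1,\dots,n$. The $t$-step transition probability is $p(t,x_j|x_i)=(M^t)_{i,j}$. The matrix $M_s=D^{1/2}MD^{-1/2}$ is symmetric and has the same eigenvalues as $M$, namely $1=\lambda_0>\lambda_1\ge\dots\ge\lambda_{n-1}\ge0$. Let $v_0,\dots,v_{n-1}$ be an orthonormal basis of $\mathbb{R}^n$ (standard dot product) with $M_sv_j=\lambda_jv_j$, where the sign of $v_0$ is chosen so that its entries are positive. Put $S=\sum_jD_{j,j}$. The left eigenvectors $\phi_j$ and right eigenvectors $\psi_j$ of $M$ are $$\phi_j=S^{-1/2}D^{1/2}v_j,\qquad \psi_j=S^{1/2}D^{-1/2}v_j ,$$ so that $\langle\phi_i,\psi_j\rangle=\delta_{i,j}$, $\phi_0(x_i)=D_{i,i}/S$ (the stationary distribution) and $\psi_0\equiv1$. The convention $0^0=1$ is used for $\lambda_j^t$ when $t=0$. *)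

theory Defs
  imports "HOL-Analysis.Analysis" "Jordan_Normal_Form.Char_Poly" "Jordan_Normal_Form.VS_Connect"
begin

unbundle no vec_syntax
unbundle no inner_syntax

(* Matrices and vectors are those of Jordan_Normal_Form, so that R^n and R^(n-1) occur in one
   statement; indices start at 0, so the data points are x 0, ..., x (n - 1). *)

definition kernel_mat :: "nat \<Rightarrow> (nat \<Rightarrow> real ^ 'p) \<Rightarrow> real \<Rightarrow> real mat" where
  "kernel_mat n x eps = Matrix.mat n n (\<lambda>(i, j). exp (- (norm (x i - x j))\<^sup>2 / (2 * eps)))"

definition deg :: "nat \<Rightarrow> (nat \<Rightarrow> real ^ 'p) \<Rightarrow> real \<Rightarrow> nat \<Rightarrow> real" where
  "deg n x eps i = (\<Sum>j<n. kernel_mat n x eps $$ (i, j))"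

(* The power D^r of the diagonal matrix D; its diagonal entries are positive, so the entrywise
   real power is the usual one for r = -1, 1/2, -1/2. *)
definition deg_mat_powr :: "nat \<Rightarrow> (nat \<Rightarrow> real ^ 'p) \<Rightarrow> real \<Rightarrow> real \<Rightarrow> real mat" where
  "deg_mat_powr n x eps r = mat_diag n (\<lambda>i. deg n x eps i powr r)"

definition markov_mat :: "nat \<Rightarrow> (nat \<Rightarrow> real ^ 'p) \<Rightarrow> real \<Rightarrow> real mat" where
  "markov_mat n x eps = deg_mat_powr n x eps (- 1) * kernel_mat n x eps"

definition sym_markov_mat :: "nat \<Rightarrow> (nat \<Rightarrow> real ^ 'p) \<Rightarrow> real \<Rightarrow> real mat" where
  "sym_markov_mat n x eps =
     deg_mat_powr n x eps (1 / 2) * markov_mat n x eps * deg_mat_powr n x eps (- (1 / 2))"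

definition volume :: "nat \<Rightarrow> (nat \<Rightarrow> real ^ 'p) \<Rightarrow> real \<Rightarrow> real" where
  "volume n x eps = (\<Sum>j<n. deg n x eps j)"

(* p(t, x_j | x_i) is trans_prob n x eps t j i. *)
definition trans_prob :: "nat \<Rightarrow> (nat \<Rightarrow> real ^ 'p) \<Rightarrow> real \<Rightarrow> nat \<Rightarrow> nat \<Rightarrow> nat \<Rightarrow> real" where
  "trans_prob n x eps t j i = (markov_mat n x eps ^\<^sub>m t) $$ (i, j)"

definition orthonormal_basis :: "nat \<Rightarrow> (nat \<Rightarrow> real vec) \<Rightarrow> bool" where
  "orthonormal_basis n v \<longleftrightarrow>
     vectorspace.basis class_ring (module_vec TYPE(real) n) (v ` {..<n}) \<and>
     (\<forall>i<n. \<forall>j<n. v i \<bullet> v j = (if i = j then 1 else 0))"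

(* phi_j and psi_j are left_eigvec n x eps (v j) and right_eigvec n x eps (v j). *)
definition left_eigvec :: "nat \<Rightarrow> (nat \<Rightarrow> real ^ 'p) \<Rightarrow> real \<Rightarrow> real vec \<Rightarrow> real vec" where
  "left_eigvec n x eps u =
     (volume n x eps powr (- (1 / 2))) \<cdot>\<^sub>v (deg_mat_powr n x eps (1 / 2) *\<^sub>v u)"

definition right_eigvec :: "nat \<Rightarrow> (nat \<Rightarrow> real ^ 'p) \<Rightarrow> real \<Rightarrow> real vec \<Rightarrow> real vec" where
  "right_eigvec n x eps u =
     (volume n x eps powr (1 / 2)) \<cdot>\<^sub>v (deg_mat_powr n x eps (- (1 / 2)) *\<^sub>v u)"

definition diffusion_dist_sq ::
  "nat \<Rightarrow> (nat \<Rightarrow> real ^ 'p) \<Rightarrow> real \<Rightarrow> (nat \<Rightarrow> real vec) \<Rightarrow> nat \<Rightarrow> nat \<Rightarrow> nat \<Rightarrow> real" where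
  "diffusion_dist_sq n x eps v t a b =
     (\<Sum>y<n. (trans_prob n x eps t y a - trans_prob n x eps t y b)\<^sup>2
              * (1 / left_eigvec n x eps (v 0) $ y))"

(* Component k of the vector (counted from 0) belongs to the eigenpair number k + 1. *)
definition diffusion_map ::
  "nat \<Rightarrow> (nat \<Rightarrow> real ^ 'p) \<Rightarrow> real \<Rightarrow> (nat \<Rightarrow> real) \<Rightarrow> (nat \<Rightarrow> real vec) \<Rightarrow> nat \<Rightarrow> nat \<Rightarrow> real vec" where
  "diffusion_map n x eps lam v t a =
     vec (n - 1) (\<lambda>k. lam (k + 1) ^ t * right_eigvec n x eps (v (k + 1)) $ a)"

definition euclid_norm :: "real vec \<Rightarrow> real" where
  "euclid_norm u = sqrt (u \<bullet> u)"

end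

theory Submission
  imports Defs
begin

text \<open>
  The symmetric matrix \<open>M\<^sub>s = D^(-1/2) L D^(-1/2)\<close> fixes the unit vector with entries \<open>sqrt (D\<^sub>i\<^sub>i / S)\<close>.
  As \<open>\<lambda>\<^sub>0 = 1\<close> is simple and \<open>v\<^sub>0\<close> is positive, this vector is \<open>v\<^sub>0\<close>, so \<open>\<phi>\<^sub>0 = D / S\<close> and \<open>\<psi>\<^sub>0 = 1\<close>.
  The spectral decomposition of \<open>M^t\<close> shows that the weighted \<open>\<ell>\<^sup>2\<close> distance of two of its rows is
  the norm of a vector with coordinates \<open>\<lambda>\<^sub>j^t (\<psi>\<^sub>j(x\<^sub>a) - \<psi>\<^sub>j(x\<^sub>b))\<close> in the orthonormal basis \<open>v\<close>;
  the coordinate \<open>j = 0\<close> vanishes because \<open>\<psi>\<^sub>0\<close> is constant.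
\<close>

section \<open>Orthonormal families in coordinates\<close>

lemma orthonormal_rows_imp_columns:
  fixes u :: "nat \<Rightarrow> nat \<Rightarrow> 'a :: field"
  assumes "\<And>i j. i < n \<Longrightarrow> j < n \<Longrightarrow> (\<Sum>y<n. u i y * u j y) = (if i = j then 1 else 0)"
    and "i < n" "j < n"
  shows "(\<Sum>k<n. u k i * u k j) = (if i = j then 1 else 0)"
proof -
  define A where "A = Matrix.mat n n (\<lambda>(i, j). u i j)"
  have A: "A \<in> carrier_mat n n" by (simp add: A_def)
  \<comment> \<open>Orthonormality of the rows says that the transpose is a right inverse of
    \<open>A\<close>; for square matrices it is then a left inverse too, which is orthonormality of
    the columns.\<close>
  have "A * transpose_mat A = 1\<^sub>m n"
    by (rule eq_matI) (auto simp: A_def scalar_prod_def assms(1) atLeast0LessThan)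
  then have "transpose_mat A * A = 1\<^sub>m n"
    using mat_mult_left_right_inverse[OF A] A by simp
  then have "(transpose_mat A * A) $$ (i, j) = 1\<^sub>m n $$ (i, j)" by simp
  then show ?thesis
    using assms(2,3) by (simp add: A_def scalar_prod_def atLeast0LessThan)
qed

text \<open>Parseval: expanding the square and summing over \<open>y\<close> first leaves the Gram
  matrix of \<open>u\<close>, whose off-diagonal entries vanish.\<close>

lemma sum_square_orthonormal:
  fixes u :: "nat \<Rightarrow> nat \<Rightarrow> 'a :: comm_ring_1"
  assumes "\<And>i j. i < n \<Longrightarrow> j < n \<Longrightarrow> (\<Sum>y<n. u i y * u j y) = (if i = j then 1 else 0)"
  shows "(\<Sum>y<n. (\<Sum>k<n. c k * u k y)\<^sup>2) = (\<Sum>k<n. (c k)\<^sup>2)"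
proof -
  have "(\<Sum>y<n. (\<Sum>k<n. c k * u k y)\<^sup>2) = (\<Sum>y<n. \<Sum>k<n. \<Sum>l<n. c k * c l * (u k y * u l y))"
    by (simp add: power2_eq_square sum_product mult_ac)
  also have "\<dots> = (\<Sum>k<n. \<Sum>y<n. \<Sum>l<n. c k * c l * (u k y * u l y))"
    by (rule sum.swap)
  also have "\<dots> = (\<Sum>k<n. \<Sum>l<n. \<Sum>y<n. c k * c l * (u k y * u l y))"
    by (intro sum.cong refl sum.swap)
  also have "\<dots> = (\<Sum>k<n. \<Sum>l<n. c k * c l * (if k = l then 1 else 0))"
    by (simp add: assms flip: sum_distrib_left)
  also have "\<dots> = (\<Sum>k<n. (c k)\<^sup>2)"
    by (intro sum.cong refl)
      (simp add: power2_eq_square if_distrib[of "\<lambda>c. _ * c"] cong: if_cong)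
  finally show ?thesis .
qed

text \<open>By symmetry, eigenvectors for different eigenvalues are orthogonal, so \<open>w\<close>
  is a multiple of \<open>u 0\<close>; unit length and positivity force the factor to be 1. This
  serves to compute \<open>v 0\<close> explicitly.\<close>

lemma positive_fixed_vector_unique:
  fixes A :: "nat \<Rightarrow> nat \<Rightarrow> real"
  assumes on: "\<And>i j. i < n \<Longrightarrow> j < n \<Longrightarrow> (\<Sum>y<n. u i y * u j y) = (if i = j then 1 else 0)"
    and sym: "\<And>i j. i < n \<Longrightarrow> j < n \<Longrightarrow> A i j = A j i"
    and eig: "\<And>k i. k < n \<Longrightarrow> i < n \<Longrightarrow> (\<Sum>j<n. A i j * u k j) = lam k * u k i"
    and lam: "\<And>k. 1 \<le> k \<Longrightarrow> k < n \<Longrightarrow> lam k \<noteq> 1"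
    and pos: "\<And>i. i < n \<Longrightarrow> 0 < u 0 i"
    and w_fix: "\<And>i. i < n \<Longrightarrow> (\<Sum>j<n. A i j * w j) = w i"
    and w_unit: "(\<Sum>i<n. (w i)\<^sup>2) = 1"
    and w_pos: "\<And>i. i < n \<Longrightarrow> 0 < w i"
    and i: "i < n"
  shows "u 0 i = w i"
proof -
  define c where "c k = (\<Sum>y<n. u k y * w y)" for k
  have c0: "c k = 0" if k: "1 \<le> k" "k < n" for k
  proof -
    \<comment> \<open>Moving \<open>A\<close> from \<open>w\<close> to \<open>u k\<close> gives
      \<open>c k = lam k * c k\<close>.\<close>
    have "c k = (\<Sum>y<n. \<Sum>z<n. u k y * (A y z * w z))"
      by (simp add: c_def w_fix flip: sum_distrib_left)
    also have "\<dots> = (\<Sum>z<n. \<Sum>y<n. u k y * (A y z * w z))"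
      by (rule sum.swap)
    also have "\<dots> = (\<Sum>z<n. \<Sum>y<n. w z * (A z y * u k y))"
      by (intro sum.cong refl) (simp add: sym mult_ac)
    also have "\<dots> = lam k * c k"
      using k by (simp add: eig c_def sum_distrib_left mult_ac flip: sum_distrib_left)
    finally show ?thesis using lam[OF k] by simp
  qed
  have w_eq: "w z = c 0 * u 0 z" if z: "z < n" for z
  proof -
    \<comment> \<open>The Kronecker delta is replaced by the sum over \<open>k\<close> of
      \<open>u k y * u k z\<close>, which expands \<open>w\<close> with coefficients
      \<open>c k\<close>.\<close>
    have "w z = (\<Sum>y<n. (if y = z then 1 else 0) * w y)"
      using z by (simp add: if_distrib[of "\<lambda>c. c * _"] cong: if_cong)
    also have "\<dots> = (\<Sum>y<n. (\<Sum>k<n. u k y * u k z) * w y)"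
      using z by (intro sum.cong refl) (simp add: orthonormal_rows_imp_columns[OF on])
    also have "\<dots> = (\<Sum>y<n. \<Sum>k<n. u k z * (u k y * w y))"
      by (simp add: sum_distrib_left sum_distrib_right mult_ac)
    also have "\<dots> = (\<Sum>k<n. \<Sum>y<n. u k z * (u k y * w y))"
      by (rule sum.swap)
    also have "\<dots> = (\<Sum>k<n. u k z * c k)"
      by (simp add: c_def sum_distrib_left)
    also have "\<dots> = (\<Sum>k\<in>{0}. u k z * c k)"
      using i c0 by (intro sum.mono_neutral_right) auto
    finally show ?thesis by simp
  qed
  have "1 = (\<Sum>y<n. (c 0)\<^sup>2 * (u 0 y * u 0 y))"
    unfolding w_unit[symmetric]
    by (intro sum.cong refl) (simp add: w_eq power2_eq_square)
  also have "\<dots> = (c 0)\<^sup>2"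
    using i on[of 0 0] by (simp flip: sum_distrib_left)
  finally have "c 0 = 1 \<or> c 0 = -1" by (simp add: power2_eq_1_iff)
  moreover have "c 0 > 0"
    using w_pos[OF i] pos[OF i] w_eq[OF i] by (simp add: zero_less_mult_iff)
  ultimately show ?thesis using w_eq[OF i] by simp
qed

section \<open>Degrees, the Markov matrix and its symmetric conjugate\<close>

lemma kernel_mat_sym:
  "i < n \<Longrightarrow> j < n \<Longrightarrow> kernel_mat n x eps $$ (i, j) = kernel_mat n x eps $$ (j, i)"
  by (simp add: kernel_mat_def norm_minus_commute)

lemma deg_pos:
  assumes "i < n"
  shows "0 < deg n x eps i"
  unfolding deg_def by (rule sum_pos) (use assms in \<open>auto simp: kernel_mat_def\<close>)

lemma volume_pos: "n \<ge> 1 \<Longrightarrow> 0 < volume n x eps"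
  unfolding volume_def by (rule sum_pos) (auto simp: deg_pos lessThan_empty_iff)

lemma kernel_mat_carrier [simp]: "kernel_mat n x eps \<in> carrier_mat n n"
  by (simp add: kernel_mat_def)

lemma deg_mat_powr_carrier [simp]: "deg_mat_powr n x eps r \<in> carrier_mat n n"
  by (simp add: deg_mat_powr_def)

lemma markov_mat_carrier [simp]: "markov_mat n x eps \<in> carrier_mat n n"
  unfolding markov_mat_def by (rule mult_carrier_mat[of _ n n]) auto

lemma markov_mat_index:
  assumes "i < n" "j < n"
  shows "markov_mat n x eps $$ (i, j) = kernel_mat n x eps $$ (i, j) / deg n x eps i"
  using assms deg_pos[OF assms(1), of x eps] kernel_mat_carrier[of n x eps]
  unfolding markov_mat_def deg_mat_powr_def
  by (subst mat_diag_mult_left[OF kernel_mat_carrier])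
     (simp add: powr_minus divide_inverse)

lemma sym_markov_mat_carrier [simp]: "sym_markov_mat n x eps \<in> carrier_mat n n"
  unfolding sym_markov_mat_def by (intro mult_carrier_mat[of _ n n]) auto

lemma sym_markov_mat_index:
  assumes "i < n" "j < n"
  shows "sym_markov_mat n x eps $$ (i, j)
    = kernel_mat n x eps $$ (i, j) / (sqrt (deg n x eps i) * sqrt (deg n x eps j))"
proof -
  note d = deg_pos[OF assms(1), of x eps] deg_pos[OF assms(2), of x eps]
  have "sym_markov_mat n x eps $$ (i, j) = deg n x eps i powr (1 / 2) *
      (kernel_mat n x eps $$ (i, j) / deg n x eps i) * deg n x eps j powr (- (1 / 2))"
    using assms unfolding sym_markov_mat_def deg_mat_powr_def
    by (subst mat_diag_mult_left[OF markov_mat_carrier], subst mat_diag_mult_right[where nr = n])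
       (simp_all add: markov_mat_index)
  also have "\<dots> = kernel_mat n x eps $$ (i, j) / (sqrt (deg n x eps i) * sqrt (deg n x eps j))"
    using d by (simp add: powr_minus powr_half_sqrt field_simps)
  finally show ?thesis .
qed

text \<open>The image under \<open>D^(1/2)\<close> of the constant vector, which \<open>M\<close>
  fixes because the rows of the kernel sum to the degrees.\<close>

lemma sqrt_deg_fixed:
  assumes "i < n"
  shows "(\<Sum>j<n. sym_markov_mat n x eps $$ (i, j) * sqrt (deg n x eps j)) = sqrt (deg n x eps i)"
proof -
  have "(\<Sum>j<n. sym_markov_mat n x eps $$ (i, j) * sqrt (deg n x eps j))
      = (\<Sum>j<n. kernel_mat n x eps $$ (i, j)) / sqrt (deg n x eps i)"
    unfolding sum_divide_distrib
  proof (intro sum.cong refl)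
    fix j assume "j \<in> {..<n}"
    then show "sym_markov_mat n x eps $$ (i, j) * sqrt (deg n x eps j)
        = kernel_mat n x eps $$ (i, j) / sqrt (deg n x eps i)"
      using assms deg_pos[of j n x eps] by (simp add: sym_markov_mat_index)
  qed
  also have "\<dots> = sqrt (deg n x eps i)"
    using deg_pos[OF assms, of x eps] by (simp add: real_div_sqrt flip: deg_def)
  finally show ?thesis .
qed

text \<open>Entrywise form of \<open>M^t = D^(-1/2) M_s^t D^(1/2)\<close>, with \<open>M_s^t\<close>
  expanded in the eigenbasis \<open>u\<close>. In the induction \<open>y\<close> is arbitrary, since
  the last jump may start at any point \<open>z\<close>.\<close>

lemma trans_prob_spectral:
  fixes u :: "nat \<Rightarrow> nat \<Rightarrow> real"
  assumes on: "\<And>i j. i < n \<Longrightarrow> j < n \<Longrightarrow> (\<Sum>y<n. u i y * u j y) = (if i = j then 1 else 0)"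
    and eig: "\<And>k i. k < n \<Longrightarrow> i < n \<Longrightarrow>
      (\<Sum>j<n. sym_markov_mat n x eps $$ (i, j) * u k j) = lam k * u k i"
    and a: "a < n"
    and y: "y < n"
  shows "trans_prob n x eps t y a = (\<Sum>k<n. lam k ^ t * u k a / sqrt (deg n x eps a) * u k y)
    * sqrt (deg n x eps y)"
  unfolding trans_prob_def using y
proof (induction t arbitrary: y)
  case 0
  \<comment> \<open>Here \<open>lam k ^ 0 = 1\<close> even if \<open>lam k = 0\<close>, so column
    orthonormality yields the identity matrix.\<close>
  have "(\<Sum>k<n. u k a / sqrt (deg n x eps a) * u k y)
      = (\<Sum>k<n. u k a * u k y) / sqrt (deg n x eps a)"
    by (simp add: sum_divide_distrib)
  then show ?case
    using 0 a deg_pos[OF a, of x eps] deg_pos[OF 0, of x eps] carrier_matD[OF markov_mat_carrier[of n x eps]]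
    by (simp add: orthonormal_rows_imp_columns[OF on])
next
  case (Suc t)
  let ?d = "deg n x eps" and ?M = "markov_mat n x eps" and ?A = "sym_markov_mat n x eps"
  let ?c = "\<lambda>k. lam k ^ t * u k a / sqrt (?d a)"
  have Mt: "?M ^\<^sub>m t \<in> carrier_mat n n" by simp
  \<comment> \<open>Both sides equal the kernel entry divided by \<open>sqrt (?d z)\<close>. The
    swapped indices let \<open>eig\<close> apply to row \<open>y\<close>.\<close>
  have M_A: "sqrt (?d z) * ?M $$ (z, y) = ?A $$ (y, z) * sqrt (?d y)" if "z < n" for z
    using that Suc.prems deg_pos[OF that, of x eps] deg_pos[OF Suc.prems, of x eps]
    by (simp add: markov_mat_index sym_markov_mat_index kernel_mat_sym[of y n z] field_simps)
  have "(?M ^\<^sub>m Suc t) $$ (a, y) = (\<Sum>z<n. (?M ^\<^sub>m t) $$ (a, z) * ?M $$ (z, y))"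
    using a Suc.prems Mt carrier_matD[OF Mt] carrier_matD[OF markov_mat_carrier[of n x eps]]
    by (simp add: scalar_prod_def atLeast0LessThan)
  also have "\<dots> = (\<Sum>z<n. (\<Sum>k<n. ?c k * u k z) * (?A $$ (y, z) * sqrt (?d y)))"
    by (intro sum.cong refl) (simp add: Suc.IH mult.assoc M_A)
  also have "\<dots> = (\<Sum>z<n. \<Sum>k<n. ?c k * (?A $$ (y, z) * u k z) * sqrt (?d y))"
    by (simp add: sum_distrib_left sum_distrib_right mult_ac)
  also have "\<dots> = (\<Sum>k<n. \<Sum>z<n. ?c k * (?A $$ (y, z) * u k z) * sqrt (?d y))"
    by (rule sum.swap)
  also have "\<dots> = (\<Sum>k<n. ?c k * (\<Sum>z<n. ?A $$ (y, z) * u k z) * sqrt (?d y))"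
    unfolding sum_distrib_left sum_distrib_right ..
  also have "\<dots> = (\<Sum>k<n. ?c k * (lam k * u k y) * sqrt (?d y))"
    using Suc.prems by (simp add: eig)
  also have "\<dots> = (\<Sum>k<n. lam k ^ Suc t * u k a / sqrt (?d a) * u k y) * sqrt (?d y)"
    by (simp add: sum_distrib_left sum_distrib_right mult_ac)
  finally show ?case .
qed

section \<open>Entries of the left and right eigenvectors\<close>

lemma mat_diag_mult_vec_index:
  assumes "u \<in> carrier_vec n" "i < n"
  shows "(mat_diag n f *\<^sub>v u) $ i = f i * u $ i"
proof -
  have "(mat_diag n f *\<^sub>v u) $ i = (\<Sum>j<n. (if i = j then f j else 0) * u $ j)"
    using assms by (simp add: mat_diag_def scalar_prod_def atLeast0LessThan)
  also have "\<dots> = (\<Sum>j<n. if i = j then f j * u $ j else 0)"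
    by (intro sum.cong) auto
  finally show ?thesis using assms by simp
qed

lemma left_eigvec_index:
  assumes "u \<in> carrier_vec n" "i < n"
  shows "left_eigvec n x eps u $ i = sqrt (deg n x eps i) * u $ i / sqrt (volume n x eps)"
proof -
  have "0 < volume n x eps" using assms by (intro volume_pos) simp
  moreover have "dim_row (mat_diag n f) = n" for f :: "nat \<Rightarrow> real"
    by (simp add: mat_diag_def)
  ultimately show ?thesis
    using assms deg_pos[OF assms(2), of x eps]
    by (simp add: left_eigvec_def deg_mat_powr_def mat_diag_mult_vec_index powr_minus
        powr_half_sqrt field_simps del: index_mult_mat_vec)
qed

lemma right_eigvec_index:
  assumes "u \<in> carrier_vec n" "i < n"
  shows "right_eigvec n x eps u $ i = sqrt (volume n x eps) * u $ i / sqrt (deg n x eps i)"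
proof -
  have "0 < volume n x eps" using assms by (intro volume_pos) simp
  moreover have "dim_row (mat_diag n f) = n" for f :: "nat \<Rightarrow> real"
    by (simp add: mat_diag_def)
  ultimately show ?thesis
    using assms deg_pos[OF assms(2), of x eps]
    by (simp add: right_eigvec_def deg_mat_powr_def mat_diag_mult_vec_index powr_minus
        powr_half_sqrt field_simps del: index_mult_mat_vec)
qed

section \<open>Diffusion distance and diffusion map\<close>

theorem mainTheorem1:
  fixes n :: nat and x :: "nat \<Rightarrow> real ^ 'p" and eps :: real
    and lam :: "nat \<Rightarrow> real" and v :: "nat \<Rightarrow> real vec" and t :: nat
  assumes "n \<ge> 1" and "eps > 0"
    and "orthonormal_basis n v"
    and "\<And>j. j < n \<Longrightarrow> eigenvector (sym_markov_mat n x eps) (v j) (lam j)"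
    and "lam 0 = 1"
    and "\<And>j. 1 \<le> j \<Longrightarrow> j < n \<Longrightarrow> lam j < lam 0"
    and "\<And>i j. 1 \<le> i \<Longrightarrow> i \<le> j \<Longrightarrow> j < n \<Longrightarrow> lam j \<le> lam i"
    and "\<And>j. j < n \<Longrightarrow> 0 \<le> lam j"
    and "\<And>i. i < n \<Longrightarrow> 0 < v 0 $ i"
  shows "\<forall>a<n. \<forall>b<n.
    diffusion_dist_sq n x eps v t a b =
      (\<Sum>j=1..n - 1. lam j ^ (2 * t) *
         (right_eigvec n x eps (v j) $ a - right_eigvec n x eps (v j) $ b)\<^sup>2) \<and>
    (\<Sum>j=1..n - 1. lam j ^ (2 * t) *
         (right_eigvec n x eps (v j) $ a - right_eigvec n x eps (v j) $ b)\<^sup>2) =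
      (euclid_norm (diffusion_map n x eps lam v t a - diffusion_map n x eps lam v t b))\<^sup>2"
proof (intro allI impI conjI)
  fix a b assume a: "a < n" and b: "b < n"
  let ?d = "deg n x eps" and ?S = "volume n x eps" and ?A = "sym_markov_mat n x eps"
  let ?psi = "\<lambda>j. right_eigvec n x eps (v j)"
  have S: "?S > 0" using assms(1) by (rule volume_pos)
  have v: "v j \<in> carrier_vec n" if "j < n" for j
    using assms(4)[OF that] carrier_matD[OF sym_markov_mat_carrier[of n x eps]]
    by (simp add: eigenvector_def)
  have on: "(\<Sum>y<n. v i $ y * v j $ y) = (if i = j then 1 else 0)" if "i < n" "j < n" for i j
  proof -
    have "v i \<bullet> v j = (if i = j then 1 else 0)"
      using assms(3) that by (simp add: orthonormal_basis_def)
    then show ?thesis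
      using v[OF that(2)] by (simp add: scalar_prod_def atLeast0LessThan)
  qed
  have eig: "(\<Sum>j<n. ?A $$ (i, j) * v k $ j) = lam k * v k $ i" if "k < n" "i < n" for k i
  proof -
    have "(?A *\<^sub>v v k) $ i = (lam k \<cdot>\<^sub>v v k) $ i"
      using assms(4)[OF that(1)] by (simp add: eigenvector_def)
    then show ?thesis
      using that v[OF that(1)] carrier_matD[OF sym_markov_mat_carrier[of n x eps]]
      by (simp add: scalar_prod_def atLeast0LessThan)
  qed
  \<comment> \<open>The fixed vector of \<open>sqrt_deg_fixed\<close>, divided by its norm
    \<open>sqrt ?S\<close>.\<close>
  have v0: "v 0 $ i = sqrt (?d i) / sqrt ?S" if "i < n" for i
  proof (rule positive_fixed_vector_unique[where A = "\<lambda>i j. ?A $$ (i, j)" and u = "\<lambda>k i. v k $ i",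
        OF on _ eig _ assms(9) _ _ _ that])
    show "?A $$ (i, j) = ?A $$ (j, i)" if "i < n" "j < n" for i j
      using that by (simp add: sym_markov_mat_index kernel_mat_sym[of i n j] mult.commute)
    show "lam k \<noteq> 1" if "1 \<le> k" "k < n" for k
      using assms(6)[OF that] assms(5) by simp
    show "(\<Sum>j<n. ?A $$ (i, j) * (sqrt (?d j) / sqrt ?S)) = sqrt (?d i) / sqrt ?S" if "i < n" for i
      using sqrt_deg_fixed[OF that, of x eps] by (simp flip: sum_divide_distrib)
    show "(\<Sum>i<n. (sqrt (?d i) / sqrt ?S)\<^sup>2) = 1"
    proof -
      have "(\<Sum>i<n. (sqrt (?d i) / sqrt ?S)\<^sup>2) = (\<Sum>i<n. ?d i / ?S)"
        using S by (intro sum.cong refl) (simp add: power_divide deg_pos less_imp_le)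
      then show ?thesis using S by (simp add: volume_def flip: sum_divide_distrib)
    qed
    show "0 < sqrt (?d i) / sqrt ?S" if "i < n" for i
      using S deg_pos[OF that, of x eps] by simp
  qed
  have psi0: "?psi 0 $ i = 1" if "i < n" for i
    using that S deg_pos[OF that, of x eps] v[of 0] by (simp add: right_eigvec_index v0)
  have phi0: "left_eigvec n x eps (v 0) $ i = ?d i / ?S" if "i < n" for i
    using that S deg_pos[OF that, of x eps] v[of 0] by (simp add: left_eigvec_index v0)
  \<comment> \<open>Coordinates in the basis \<open>v\<close> of the difference of rows
    \<open>a\<close> and \<open>b\<close> of \<open>M^t\<close>, each entry being divided by
    \<open>sqrt (?d y) / sqrt ?S\<close>.\<close>
  let ?c = "\<lambda>k. lam k ^ t * (?psi k $ a - ?psi k $ b)"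
  have "diffusion_dist_sq n x eps v t a b = (\<Sum>y<n. (\<Sum>k<n. ?c k * v k $ y)\<^sup>2)"
    unfolding diffusion_dist_sq_def
  proof (intro sum.cong refl)
    fix y assume "y \<in> {..<n}"
    then have y: "y < n" by simp
    have psi: "lam k ^ t * v k $ i / sqrt (?d i) = lam k ^ t * ?psi k $ i / sqrt ?S"
      if "k < n" "i < n" for k i
      using that S by (simp add: right_eigvec_index v)
    have tp: "trans_prob n x eps t y i
        = (\<Sum>k<n. lam k ^ t * ?psi k $ i * v k $ y) * (sqrt (?d y) / sqrt ?S)" if "i < n" for i
      using that
      by (simp add: trans_prob_spectral[where u = "\<lambda>k i. v k $ i", OF on eig that y] psi
          flip: sum_divide_distrib)
    have "trans_prob n x eps t y a - trans_prob n x eps t y b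
        = (\<Sum>k<n. ?c k * v k $ y) * (sqrt (?d y) / sqrt ?S)"
      by (simp add: tp a b algebra_simps sum_subtractf flip: diff_divide_distrib)
    \<comment> \<open>The weight \<open>1 / phi_0(y) = ?S / ?d y\<close> cancels the square of
      \<open>sqrt (?d y) / sqrt ?S\<close>.\<close>
    then show "(trans_prob n x eps t y a - trans_prob n x eps t y b)\<^sup>2
        * (1 / left_eigvec n x eps (v 0) $ y) = (\<Sum>k<n. ?c k * v k $ y)\<^sup>2"
      using S deg_pos[OF y, of x eps] by (simp add: phi0 y power_mult_distrib power_divide)
  qed
  also have "\<dots> = (\<Sum>k<n. (?c k)\<^sup>2)"
    by (rule sum_square_orthonormal) (rule on)
  \<comment> \<open>The term \<open>k = 0\<close> vanishes because \<open>?psi 0\<close> is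
    constant; for \<open>n = 1\<close> the remaining range is empty.\<close>
  also have "\<dots> = (\<Sum>k=1..n - 1. (?c k)\<^sup>2)"
    using a b by (intro sum.mono_neutral_right) (auto simp: psi0 not_le)
  finally show "diffusion_dist_sq n x eps v t a b
      = (\<Sum>j=1..n - 1. lam j ^ (2 * t) * (?psi j $ a - ?psi j $ b)\<^sup>2)"
    by (simp add: power_mult_distrib power_mult[of _ t 2] mult.commute[of 2 t])
  let ?w = "diffusion_map n x eps lam v t a - diffusion_map n x eps lam v t b"
  \<comment> \<open>Components are counted from 0 but start with eigenpair 1, hence the shift,
    undone below by reindexing.\<close>
  have w: "?w \<bullet> ?w = (\<Sum>k<n - 1. (?c (k + 1))\<^sup>2)"
    by (simp add: diffusion_map_def scalar_prod_def atLeast0LessThan power2_eq_square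
        right_diff_distrib)
  then have "(euclid_norm ?w)\<^sup>2 = (\<Sum>k<n - 1. (?c (k + 1))\<^sup>2)"
    by (simp add: euclid_norm_def sum_nonneg)
  also have "\<dots> = (\<Sum>j=1..n - 1. (?c j)\<^sup>2)"
    using sum.atLeast1_atMost_eq[of "\<lambda>j. (?c j)\<^sup>2" "n - 1"] by simp
  finally show "(\<Sum>j=1..n - 1. lam j ^ (2 * t) * (?psi j $ a - ?psi j $ b)\<^sup>2) = (euclid_norm ?w)\<^sup>2"
    by (simp add: power_mult_distrib power_mult[of _ t 2] mult.commute[of 2 t])
qed

end
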